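(* Let $\sigma$ be a subsequence of $e\,w_l\,w_r\,c$ containing $w_l$. Then the varieties $\mathring{\mathbb{M}}^{sl}_\sigma$, $\mathring{\mathbb{M}}^{\ell}_\sigma$, $\mathbb{PM}^{sl}_\sigma$ and $\mathbb{PM}^{\ell}_\sigma$ have the finite embeddability property.
   Context: For a subsequence $\sigma$ of $e\,w_l\,w_r\,c$ ($a\le b$ means $a\vee b=b$): $\mathring{\mathbb{M}}^{sl}_\sigma$ is the class of algebras $\langle A,\vee,*,0,1\rangle$ with $\langle A,\vee\rangle$ a join-semilattice, $\langle A,*,1\rangle$ a monoid, $*$ distributing over $\vee$ on both sides, $0$ an arbitrary element, and satisfying, for each letter in $\sigma$: $e$: $x*y=y*x$; $w_l$: $x\le 1$; $w_r$: $0\le x$; $c$: $x\le x*x$. $\mathring{\mathbb{M}}^{\ell}_\sigma$ is the class of algebras $\langle A,\vee,\wedge,*,0,1\rangle$ whose $\langle\vee,\wedge\rangle$-reduct is a lattice and whose $\langle\vee,*,0,1\rangle$-reduct lies in $\mathring{\mathbb{M}}^{sl}_\sigma$. $\mathbb{PM}^{sl}_\sigma$ (resp. $\mathbb{PM}^{\ell}_\sigma$) is the class of algebras $\langle A,\vee,*,\neg_r,\neg_l,0,1\rangle$ (resp. $\langle A,\vee,\wedge,*,\neg_r,\neg_l,0,1\rangle$) with unary $\neg_r,\neg_l$ whose reduct without $\neg_r,\neg_l$ lies in $\mathring{\mathbb{M}}^{sl}_\sigma$ (resp. $\mathring{\mathbb{M}}^{\ell}_\sigma$) and such that for all $a,b$: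 $a*b\le0$ iff $b\le\neg_r a$ iff $a\le\neg_l b$. A class $\mathbb{K}$ of algebras has the finite embeddability property if for every $\mathbf{A}\in\mathbb{K}$ and every finite subset $B\subseteq A$, regarded as a partial algebra (each operation defined on tuples from $B$ exactly when its value in $\mathbf{A}$ lies in $B$), there is a finite $\mathbf{D}\in\mathbb{K}$ and an injective map $B\to D$ preserving all the defined operations. *)

theory Defs
  imports "HOL-Algebra.Group" "HOL-Library.Sublist"
begin

type_synonym 'f signature = "'f \<rightharpoonup> nat"

record ('a, 'f) algebra = "'a partial_object" +
  interp :: "'f \<Rightarrow> 'a list \<Rightarrow> 'a"

definition is_algebra :: "'f signature \<Rightarrow> ('a, 'f) algebra \<Rightarrow> bool" where
  "is_algebra S A \<longleftrightarrow>
     (\<forall>f n xs. S f = Some n \<and> length xs = n \<and> set xs \<subseteq> carrier A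
        \<longrightarrow> interp A f xs \<in> carrier A)"

text \<open>A set \<open>B\<close> of elements of \<open>A\<close> is regarded as a partial algebra: \<open>f\<close> is defined on a tuple
  \<open>xs\<close> from \<open>B\<close> exactly when \<open>interp A f xs\<close> lies in \<open>B\<close>. Constants are the case \<open>xs = []\<close>, so
  a constant has to be preserved only if it belongs to \<open>B\<close>.\<close>

definition partial_embedding ::
    "'f signature \<Rightarrow> ('a, 'f) algebra \<Rightarrow> 'a set \<Rightarrow> ('b, 'f) algebra \<Rightarrow> ('a \<Rightarrow> 'b) \<Rightarrow> bool" where
  "partial_embedding S A B D h \<longleftrightarrow>
     h ` B \<subseteq> carrier D \<and> inj_on h B \<and>
     (\<forall>f n xs. S f = Some n \<and> length xs = n \<and> set xs \<subseteq> B \<and> interp A f xs \<in> B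
        \<longrightarrow> h (interp A f xs) = interp D f (map h xs))"

text \<open>A class is given by its members with carrier in a type \<open>'a\<close>. For a class closed under
  isomorphism it is no restriction to look for the finite \<open>D\<close> over the same type: if \<open>'a\<close> is
  infinite, every finite algebra has an isomorphic copy with carrier in \<open>'a\<close>; if \<open>'a\<close> is
  finite, so is \<open>A\<close>, and \<open>D = A\<close> will do.\<close>

definition finite_embeddability_property ::
    "'f signature \<Rightarrow> ('a, 'f) algebra set \<Rightarrow> bool" where
  "finite_embeddability_property S K \<longleftrightarrow>
     (\<forall>A\<in>K. \<forall>B. finite B \<and> B \<subseteq> carrier A \<longrightarrow>
        (\<exists>D\<in>K. finite (carrier D) \<and> (\<exists>h. partial_embedding S A B D h)))"

datatype opsym = Join | Meet | Times | NegR | NegL | Zero | One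

definition sl_sig :: "opsym signature" where
  "sl_sig = [Join \<mapsto> 2, Times \<mapsto> 2, Zero \<mapsto> 0, One \<mapsto> 0]"

definition lat_sig :: "opsym signature" where
  "lat_sig = sl_sig(Meet \<mapsto> 2)"

definition p_sl_sig :: "opsym signature" where
  "p_sl_sig = sl_sig(NegR \<mapsto> 1, NegL \<mapsto> 1)"

definition p_lat_sig :: "opsym signature" where
  "p_lat_sig = lat_sig(NegR \<mapsto> 1, NegL \<mapsto> 1)"

abbreviation join :: "('a, opsym) algebra \<Rightarrow> 'a \<Rightarrow> 'a \<Rightarrow> 'a" where
  "join A x y \<equiv> interp A Join [x, y]"

abbreviation meet :: "('a, opsym) algebra \<Rightarrow> 'a \<Rightarrow> 'a \<Rightarrow> 'a" where
  "meet A x y \<equiv> interp A Meet [x, y]"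

abbreviation times :: "('a, opsym) algebra \<Rightarrow> 'a \<Rightarrow> 'a \<Rightarrow> 'a" where
  "times A x y \<equiv> interp A Times [x, y]"

abbreviation negr :: "('a, opsym) algebra \<Rightarrow> 'a \<Rightarrow> 'a" where
  "negr A x \<equiv> interp A NegR [x]"

abbreviation negl :: "('a, opsym) algebra \<Rightarrow> 'a \<Rightarrow> 'a" where
  "negl A x \<equiv> interp A NegL [x]"

abbreviation zero_of :: "('a, opsym) algebra \<Rightarrow> 'a" where
  "zero_of A \<equiv> interp A Zero []"

abbreviation one_of :: "('a, opsym) algebra \<Rightarrow> 'a" where
  "one_of A \<equiv> interp A One []"

definition below :: "('a, opsym) algebra \<Rightarrow> 'a \<Rightarrow> 'a \<Rightarrow> bool" where
  "below A x y \<longleftrightarrow> join A x y = y"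

definition semilattice_on :: "'a set \<Rightarrow> ('a \<Rightarrow> 'a \<Rightarrow> 'a) \<Rightarrow> bool" where
  "semilattice_on X f \<longleftrightarrow>
     (\<forall>x\<in>X. \<forall>y\<in>X. f x y \<in> X) \<and>
     (\<forall>x\<in>X. \<forall>y\<in>X. \<forall>z\<in>X. f (f x y) z = f x (f y z)) \<and>
     (\<forall>x\<in>X. \<forall>y\<in>X. f x y = f y x) \<and>
     (\<forall>x\<in>X. f x x = x)"

definition lattice_on :: "'a set \<Rightarrow> ('a \<Rightarrow> 'a \<Rightarrow> 'a) \<Rightarrow> ('a \<Rightarrow> 'a \<Rightarrow> 'a) \<Rightarrow> bool" where
  "lattice_on X j m \<longleftrightarrow> semilattice_on X j \<and> semilattice_on X m \<and>
     (\<forall>x\<in>X. \<forall>y\<in>X. j x (m x y) = x) \<and> (\<forall>x\<in>X. \<forall>y\<in>X. m x (j x y) = x)"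

datatype letter = L_e | L_wl | L_wr | L_c

fun satisfies :: "('a, opsym) algebra \<Rightarrow> letter \<Rightarrow> bool" where
  "satisfies A L_e \<longleftrightarrow> (\<forall>x\<in>carrier A. \<forall>y\<in>carrier A. times A x y = times A y x)"
| "satisfies A L_wl \<longleftrightarrow> (\<forall>x\<in>carrier A. below A x (one_of A))"
| "satisfies A L_wr \<longleftrightarrow> (\<forall>x\<in>carrier A. below A (zero_of A) x)"
| "satisfies A L_c \<longleftrightarrow> (\<forall>x\<in>carrier A. below A x (times A x x))"

text \<open>All four classes share the symbol type \<^typ>\<open>opsym\<close>; interpretations of symbols outside the
  signature of a class are irrelevant. Thus an algebra of a larger signature also serves as
  its own reduct.\<close>

definition M_sl :: "letter list \<Rightarrow> ('a, opsym) algebra set" where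
  "M_sl \<sigma> = {A. is_algebra sl_sig A \<and>
     semilattice_on (carrier A) (join A) \<and>
     monoid \<lparr>carrier = carrier A, mult = times A, one = one_of A\<rparr> \<and>
     (\<forall>x\<in>carrier A. \<forall>y\<in>carrier A. \<forall>z\<in>carrier A.
        times A x (join A y z) = join A (times A x y) (times A x z) \<and>
        times A (join A x y) z = join A (times A x z) (times A y z)) \<and>
     (\<forall>l\<in>set \<sigma>. satisfies A l)}"

definition M_lat :: "letter list \<Rightarrow> ('a, opsym) algebra set" where
  "M_lat \<sigma> = {A. is_algebra lat_sig A \<and> lattice_on (carrier A) (join A) (meet A) \<and> A \<in> M_sl \<sigma>}"

definition pseudocomplements :: "('a, opsym) algebra \<Rightarrow> bool" where
  "pseudocomplements A \<longleftrightarrow> (\<forall>a\<in>carrier A. \<forall>b\<in>carrier A.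
     (below A (times A a b) (zero_of A) \<longleftrightarrow> below A b (negr A a)) \<and>
     (below A b (negr A a) \<longleftrightarrow> below A a (negl A b)))"

definition PM_sl :: "letter list \<Rightarrow> ('a, opsym) algebra set" where
  "PM_sl \<sigma> = {A. is_algebra p_sl_sig A \<and> A \<in> M_sl \<sigma> \<and> pseudocomplements A}"

definition PM_lat :: "letter list \<Rightarrow> ('a, opsym) algebra set" where
  "PM_lat \<sigma> = {A. is_algebra p_lat_sig A \<and> A \<in> M_lat \<sigma> \<and> pseudocomplements A}"

end

(*  Replace elements of A by words over the finite set S = B \<union> {0, 1} and let the closed sets be the
    intersections of the sets {w. p w q \<le> b} with p, q words and b in S. The closed sets carry
    the structure of a residuated lattice, which inherits e, w_r and c, and b \<mapsto> {w. w \<le> b} preserves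
    all operations that are defined in B. Since x \<le> 1, inserting letters into a word makes its value
    smaller, so these sets are upwards closed for the subword order. By Higman's lemma that order
    is a well-quasi-order, which leaves only finitely many sets {w. p w q \<le> b}.  *)

theory Submission
  imports Defs "HOL-Library.Infinite_Set"
begin

subsection \<open>Higman's lemma for a finite alphabet\<close>

text \<open>Higman's lemma alone does not bound the number of polars: a well-quasi-order such as the
  natural numbers has infinitely many upsets. What helps is a second use of it: for fixed
  \<open>b\<close> the polar grows with the context \<open>(p, q)\<close>, and contexts are pairs of
  words, so they are well-quasi-ordered too. The contexts are there to make the closure compatible
  with concatenation, that is, a nucleus on sets of words; this is what yields an associative
  product distributing over joins, together with residuals. The closed sets have meets and both
  negations whatever \<open>A\<close> has, so one construction serves all four classes. Meets and
  negations of \<open>A\<close> matter only when their preservation is checked. The bound 0 belongs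
  to \<open>S\<close> because the negations are residuals of \<open>down (zero_of A)\<close>. The
  closed sets live in another type than \<open>A\<close>, so the finite algebra is finally copied
  into the type of \<open>A\<close>.\<close>

text \<open>The form with a homogeneous infinite subsequence, rather than a single good pair, makes
  unions and products a matter of passing to subsequences.\<close>

definition wqo_on :: "('b \<Rightarrow> 'b \<Rightarrow> bool) \<Rightarrow> 'b set \<Rightarrow> bool" where
  "wqo_on R X \<longleftrightarrow> (\<forall>f. (\<forall>i::nat. f i \<in> X) \<longrightarrow>
     (\<exists>r::nat \<Rightarrow> nat. strict_mono r \<and> (\<forall>i j. i < j \<longrightarrow> R (f (r i)) (f (r j)))))"

lemma wqo_onE:
  assumes "wqo_on R X" and "\<And>i::nat. f i \<in> X"
  obtains r :: "nat \<Rightarrow> nat" where "strict_mono r" "\<And>i j. i < j \<Longrightarrow> R (f (r i)) (f (r j))"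
  using assms unfolding wqo_on_def by blast

lemma wqo_on_subset: "wqo_on R X \<Longrightarrow> Y \<subseteq> X \<Longrightarrow> wqo_on R Y"
  unfolding wqo_on_def by blast

lemma wqo_on_subsequence:
  assumes "wqo_on R X" and r: "strict_mono r" and "\<And>i::nat. f (r i) \<in> X"
  shows "\<exists>r::nat \<Rightarrow> nat. strict_mono r \<and> (\<forall>i j. i < j \<longrightarrow> R (f (r i)) (f (r j)))"
proof -
  obtain s :: "nat \<Rightarrow> nat" where "strict_mono s"
    "\<And>i j. i < j \<Longrightarrow> R (f (r (s i))) (f (r (s j)))"
    using wqo_onE[OF assms(1), of "\<lambda>i. f (r i)"] assms(3) by blast
  then show ?thesis
    using r by (intro exI[of _ "r \<circ> s"]) (auto simp: strict_mono_def)
qed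

lemma wqo_on_Un:
  assumes X: "wqo_on R X" and Y: "wqo_on R Y"
  shows "wqo_on R (X \<union> Y)"
  unfolding wqo_on_def
proof (intro allI impI)
  fix f :: "nat \<Rightarrow> 'a"
  assume f: "\<forall>i. f i \<in> X \<union> Y"
  then have "{i. f i \<in> X} \<union> {i. f i \<in> Y} = UNIV" by auto
  then have "infinite {i. f i \<in> X} \<or> infinite {i. f i \<in> Y}"
    by (metis finite_UnI infinite_UNIV_nat)
  then show "\<exists>r::nat \<Rightarrow> nat. strict_mono r \<and> (\<forall>i j. i < j \<longrightarrow> R (f (r i)) (f (r j)))"
    using wqo_on_subsequence[OF X, of _ f] wqo_on_subsequence[OF Y, of _ f]
      infinite_enumerate by (metis mem_Collect_eq)
qed

lemma wqo_on_image:
  assumes X: "wqo_on R X"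
    and mono: "\<And>x y. x \<in> X \<Longrightarrow> y \<in> X \<Longrightarrow> R x y \<Longrightarrow> Q (g x) (g y)"
  shows "wqo_on Q (g ` X)"
  unfolding wqo_on_def
proof (intro allI impI)
  fix f :: "nat \<Rightarrow> 'b"
  assume "\<forall>i. f i \<in> g ` X"
  then obtain e where e: "\<And>i. e i \<in> X" "\<And>i. f i = g (e i)"
    unfolding image_iff by metis
  then show "\<exists>r::nat \<Rightarrow> nat. strict_mono r \<and> (\<forall>i j. i < j \<longrightarrow> Q (f (r i)) (f (r j)))"
    using wqo_onE[OF X, of e] mono by metis
qed

lemma wqo_on_Times:
  assumes X: "wqo_on R X" and Y: "wqo_on Q Y"
  shows "wqo_on (rel_prod R Q) (X \<times> Y)"
  unfolding wqo_on_def
proof (intro allI impI)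
  fix f :: "nat \<Rightarrow> 'a \<times> 'b"
  assume f: "\<forall>i. f i \<in> X \<times> Y"
  obtain r :: "nat \<Rightarrow> nat" where r: "strict_mono r"
      "\<And>i j. i < j \<Longrightarrow> R (fst (f (r i))) (fst (f (r j)))"
    using wqo_onE[OF X, of "\<lambda>i. fst (f i)"] f by (metis mem_Times_iff)
  obtain s :: "nat \<Rightarrow> nat" where s: "strict_mono s"
      "\<And>i j. i < j \<Longrightarrow> Q (snd (f (r (s i)))) (snd (f (r (s j))))"
    using wqo_onE[OF Y, of "\<lambda>i. snd (f (r i))"] f by (metis mem_Times_iff)
  show "\<exists>r::nat \<Rightarrow> nat. strict_mono r \<and> (\<forall>i j. i < j \<longrightarrow> rel_prod R Q (f (r i)) (f (r j)))"
    using r s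
    by (intro exI[of _ "r \<circ> s"]) (auto simp: rel_prod_sel strict_mono_def)
qed

text \<open>If every term of a sequence has a later term above it, dependent choice and transitivity
  give an ascending subsequence. Otherwise some term is below no later one, and the tail after it
  stays in one of the avoiding sets.\<close>

lemma wqo_on_if_avoiding:
  assumes trans: "transp R"
    and avoid: "\<And>x. x \<in> X \<Longrightarrow> wqo_on R {y \<in> X. \<not> R x y}"
  shows "wqo_on R X"
  unfolding wqo_on_def
proof (intro allI impI)
  fix f :: "nat \<Rightarrow> 'a"
  assume f: "\<forall>i. f i \<in> X"
  show "\<exists>r::nat \<Rightarrow> nat. strict_mono r \<and> (\<forall>i j. i < j \<longrightarrow> R (f (r i)) (f (r j)))"
  proof (cases "\<forall>n. \<exists>m>n. R (f n) (f m)")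
    case True
    then obtain r :: "nat \<Rightarrow> nat" where r: "\<And>n. r n < r (Suc n)" "\<And>n. R (f (r n)) (f (r (Suc n)))"
      using dependent_nat_choice[of "\<lambda>_ _. True" "\<lambda>_ n m. n < m \<and> R (f n) (f m)"] by auto
    have "R (f (r i)) (f (r j))" if "i < j" for i j
      using that
    proof (induction j)
      case (Suc j)
      then show ?case
        using r(2)[of j] transpD[OF trans] by (metis less_SucE)
    qed simp
    then show ?thesis
      using r(1) by (auto simp: strict_mono_Suc_iff)
  next
    case False
    then obtain n where n: "\<And>m. m > n \<Longrightarrow> \<not> R (f n) (f m)" by blast
    show ?thesis
      \<comment> \<open>The shift is by \<open>Suc n\<close>: only the terms strictly after index
        \<open>n\<close> are known to avoid \<open>f n\<close>.\<close>
      using f n by (intro wqo_on_subsequence[OF avoid[of "f n"], of "\<lambda>i. i + Suc n"])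
        (auto simp: strict_mono_def)
  qed
qed

text \<open>A word over \<open>S\<close> that avoids \<open>a # w\<close> either avoids the letter \<open>a\<close>, or factors at the first
  occurrence of \<open>a\<close> as \<open>u @ a # v\<close> where \<open>u\<close> avoids \<open>a\<close> and \<open>v\<close> avoids \<open>w\<close>.\<close>

lemma higman_finite_alphabet:
  assumes "finite S"
  shows "wqo_on subseq (lists S)"
  using assms
proof (induction S rule: finite_psubset_induct)
  case (psubset S)
  have avoid: "wqo_on subseq {v \<in> lists S. \<not> subseq w v}" if "w \<in> lists S" for w
    using that
  proof (induction w)
    case Nil
    \<comment> \<open>Every word contains the empty word, so the set is empty and no sequence needs
      treatment.\<close>
    then show ?case by (simp add: wqo_on_def)
  next
    case (Cons a w)
    let ?L = "lists (S - {a})" and ?M = "{v \<in> lists S. \<not> subseq w v}"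
    have L: "wqo_on subseq ?L"
      using Cons.hyps by (intro psubset.IH) auto
    have M: "wqo_on subseq ?M"
      using Cons.IH Cons.hyps by simp
    have "wqo_on subseq ((\<lambda>(u, v). u @ a # v) ` (?L \<times> ?M))"
      using wqo_on_image[OF wqo_on_Times[OF L M], of subseq "\<lambda>(u, v). u @ a # v"]
      by (auto simp: list_emb_append_mono)
    moreover have "v \<in> ?L \<union> (\<lambda>(u, v). u @ a # v) ` (?L \<times> ?M)"
      if v: "v \<in> lists S" "\<not> subseq (a # w) v" for v
    proof (cases "a \<in> set v")
      case True
      then obtain x y where xy: "v = x @ a # y" "a \<notin> set x"
        by (meson split_list_first)
      \<comment> \<open>An embedding of \<open>w\<close> into \<open>y\<close> would extend to one
        of \<open>a # w\<close> into \<open>a # y\<close>, hence into \<open>v\<close>.\<close>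
      then have "\<not> subseq w y"
        using v by (metis list_emb_append2 subseq_Cons2_iff)
      with xy v show ?thesis by (auto simp: image_iff)
    next
      case False
      with v show ?thesis by auto
    qed
    ultimately show ?case
      using wqo_on_subset[OF wqo_on_Un[OF L]] by (metis (mono_tags, lifting) mem_Collect_eq subsetI)
  qed
  show ?case
    by (rule wqo_on_if_avoiding[OF _ avoid]) (auto intro: transpI subseq_order.trans)
qed

text \<open>An infinite family would contain a strictly ascending chain of upsets of \<open>Y\<close>, which is
  impossible in a well-quasi-order.\<close>

lemma finite_upsets_wqo:
  assumes X: "wqo_on R X" and Y: "wqo_on Q Y"
    and sub: "\<And>x. x \<in> X \<Longrightarrow> U x \<subseteq> Y"
    and up: "\<And>x v w. x \<in> X \<Longrightarrow> v \<in> U x \<Longrightarrow> w \<in> Y \<Longrightarrow> Q v w \<Longrightarrow> w \<in> U x"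
    and mono: "\<And>x y. x \<in> X \<Longrightarrow> y \<in> X \<Longrightarrow> R x y \<Longrightarrow> U x \<subseteq> U y"
  shows "finite (U ` X)"
proof (rule ccontr)
  assume "infinite (U ` X)"
  then obtain e :: "nat \<Rightarrow> _" where "inj e" "range e \<subseteq> U ` X"
    using infinite_countable_subset by blast
  then have "\<forall>i. \<exists>x. x \<in> X \<and> e i = U x" by blast
  then obtain x where x: "\<And>i. x i \<in> X" "\<And>i. e i = U (x i)" by metis
  obtain r :: "nat \<Rightarrow> nat" where r: "strict_mono r" "\<And>i j. i < j \<Longrightarrow> R (x (r i)) (x (r j))"
    using wqo_onE[of R X x, OF X x(1)] by blast
  define V where "V i = U (x (r i))" for i :: nat
  have V_mono: "V i \<subseteq> V j" if "i \<le> j" for i j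
    using that mono[OF x(1) x(1)] r(2) unfolding V_def by (metis le_eq_less_or_eq order_refl)
  have "V i \<noteq> V (Suc i)" for i
    using \<open>inj e\<close> r(1) unfolding V_def x(2)[symmetric]
    by (metis injD lessI less_irrefl strict_mono_less)
  then have "\<exists>w. w \<in> V (Suc i) - V i" for i
    using V_mono[of i "Suc i"] by auto
  then obtain w where w: "\<And>i. w i \<in> V (Suc i) - V i"
    by metis
  have "w i \<in> Y" for i
    using w[of i] sub[OF x(1)] unfolding V_def by blast
  note w_Y = this
  obtain s :: "nat \<Rightarrow> nat" where s: "strict_mono s" "\<And>i j. i < j \<Longrightarrow> Q (w (s i)) (w (s j))"
    using wqo_onE[of Q Y w, OF Y w_Y] by blast
  define i j where "i = s 0" and "j = s 1"
  then have ij: "i < j" "Q (w i) (w j)"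
    using s by (simp_all add: strict_mono_less)
  \<comment> \<open>The upset \<open>V (Suc i)\<close> contains \<open>w i\<close>, hence also
    \<open>w j\<close>; since \<open>Suc i \<le> j\<close>, this puts \<open>w j\<close> into
    \<open>V j\<close>, which it was chosen to avoid.\<close>
  then have "w j \<in> V (Suc i)"
    using w[of i] up[OF x(1) _ w_Y] unfolding V_def by blast
  then show False
    using V_mono[of "Suc i" j] ij(1) w[of j] by auto
qed

subsection \<open>The algebra of closed sets of words\<close>

lemma is_algebra_mono:
  assumes "is_algebra T D" "S \<subseteq>\<^sub>m T"
  shows "is_algebra S D"
proof -
  have "T f = Some n" if "S f = Some n" for f n
    using assms(2) that by (metis domI map_le_def)
  then show ?thesis
    using assms(1) unfolding is_algebra_def by blast
qed

lemma sig_le: "sl_sig \<subseteq>\<^sub>m p_lat_sig" "lat_sig \<subseteq>\<^sub>m p_lat_sig" "p_sl_sig \<subseteq>\<^sub>m p_lat_sig"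
  by (auto simp: map_le_def p_lat_sig_def lat_sig_def p_sl_sig_def sl_sig_def)

lemma p_lat_sig_cases:
  assumes "p_lat_sig f = Some n" "length xs = n"
  obtains (Join) x y where "f = Join" "xs = [x, y]"
    | (Meet) x y where "f = Meet" "xs = [x, y]"
    | (Times) x y where "f = Times" "xs = [x, y]"
    | (NegR) x where "f = NegR" "xs = [x]"
    | (NegL) x where "f = NegL" "xs = [x]"
    | (Zero) "f = Zero" "xs = []"
    | (One) "f = One" "xs = []"
proof -
  have "\<exists>x. xs = [x]" if "n = Suc 0"
    using that assms(2) by (simp add: length_Suc_conv)
  moreover have "\<exists>x y. xs = [x, y]" if "n = Suc (Suc 0)"
    using that assms(2) by (auto simp: length_Suc_conv)
  ultimately show thesis
    using assms that
    by (cases f) (auto simp: p_lat_sig_def lat_sig_def sl_sig_def numeral_2_eq_2)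
qed

lemma is_algebra_p_lat_iff:
  "is_algebra p_lat_sig D \<longleftrightarrow>
    (\<forall>x\<in>carrier D. \<forall>y\<in>carrier D. join D x y \<in> carrier D \<and> meet D x y \<in> carrier D
       \<and> times D x y \<in> carrier D) \<and>
    (\<forall>x\<in>carrier D. negr D x \<in> carrier D \<and> negl D x \<in> carrier D) \<and>
    zero_of D \<in> carrier D \<and> one_of D \<in> carrier D" (is "_ \<longleftrightarrow> ?R")
proof
  assume "is_algebra p_lat_sig D"
  then have "interp D f xs \<in> carrier D"
    if "p_lat_sig f = Some (length xs)" "set xs \<subseteq> carrier D" for f xs
    using that by (simp add: is_algebra_def)
  then show ?R
    by (simp add: p_lat_sig_def lat_sig_def sl_sig_def)
next
  assume R: ?R
  show "is_algebra p_lat_sig D"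
    unfolding is_algebra_def
  proof (intro allI impI, elim conjE)
    fix f n xs
    assume f: "p_lat_sig f = Some n" "length xs = n" and xs: "set xs \<subseteq> carrier D"
    from f xs R show "interp D f xs \<in> carrier D"
      by (cases rule: p_lat_sig_cases) auto
  qed
qed

text \<open>Stated for any semilattice because it is read in two ways: for the join it is the least
  upper bound property, for the meet the greatest lower bound property.\<close>

lemma semilattice_on_absorb_iff:
  assumes "semilattice_on X f" "x \<in> X" "y \<in> X" "z \<in> X"
  shows "f (f x y) z = z \<longleftrightarrow> f x z = z \<and> f y z = z"
  using assms unfolding semilattice_on_def by metis

text \<open>Only the semilattice and monoid structure of \<open>A\<close> is fixed here; a lattice
  structure or pseudocomplements appear as hypotheses where the corresponding operation is shown to
  be preserved.\<close>

locale integral_sl_monoid =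
  fixes A :: "('a, opsym) algebra" and \<sigma> :: "letter list" and S :: "'a set"
  assumes A: "A \<in> M_sl \<sigma>" and wl: "L_wl \<in> set \<sigma>"
    and finite_S: "finite S" and S_carrier: "S \<subseteq> carrier A"
    and zero_S: "zero_of A \<in> S" and one_S: "one_of A \<in> S"
begin

abbreviation leq (infix "\<preceq>" 50) where "x \<preceq> y \<equiv> below A x y"

lemma zero_closed: "zero_of A \<in> carrier A" and one_closed: "one_of A \<in> carrier A"
  using zero_S one_S S_carrier by auto

lemma sl: "semilattice_on (carrier A) (join A)"
  using A by (simp add: M_sl_def)

lemma mon: "monoid \<lparr>carrier = carrier A, mult = times A, one = one_of A\<rparr>"
  using A by (simp add: M_sl_def)

lemma times_closed: "x \<in> carrier A \<Longrightarrow> y \<in> carrier A \<Longrightarrow> times A x y \<in> carrier A"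
  using monoid.m_closed[OF mon] by simp

lemma times_assoc:
  "x \<in> carrier A \<Longrightarrow> y \<in> carrier A \<Longrightarrow> z \<in> carrier A \<Longrightarrow>
    times A (times A x y) z = times A x (times A y z)"
  using monoid.m_assoc[OF mon] by simp

lemma times_one:
  assumes "x \<in> carrier A"
  shows "times A (one_of A) x = x" "times A x (one_of A) = x"
  using monoid.l_one[OF mon, of x] monoid.r_one[OF mon, of x] assms by simp_all

lemma times_join:
  assumes "x \<in> carrier A" "y \<in> carrier A" "z \<in> carrier A"
  shows "times A x (join A y z) = join A (times A x y) (times A x z)"
    "times A (join A x y) z = join A (times A x z) (times A y z)"
  using A assms by (simp_all add: M_sl_def)

lemma leq_refl: "x \<in> carrier A \<Longrightarrow> x \<preceq> x"
  using sl by (simp add: below_def semilattice_on_def)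

lemma leq_trans:
  assumes "x \<preceq> y" "y \<preceq> z" "x \<in> carrier A" "y \<in> carrier A" "z \<in> carrier A"
  shows "x \<preceq> z"
  using sl assms unfolding below_def semilattice_on_def by metis

lemma leq_antisym:
  assumes "x \<preceq> y" "y \<preceq> x" "x \<in> carrier A" "y \<in> carrier A"
  shows "x = y"
  using sl assms unfolding below_def semilattice_on_def by metis

lemma join_leq_iff:
  assumes "x \<in> carrier A" "y \<in> carrier A" "z \<in> carrier A"
  shows "join A x y \<preceq> z \<longleftrightarrow> x \<preceq> z \<and> y \<preceq> z"
  using semilattice_on_absorb_iff[OF sl] assms by (simp add: below_def)

lemma times_mono:
  assumes "x \<preceq> x'" "y \<preceq> y'"
    and "x \<in> carrier A" "x' \<in> carrier A" "y \<in> carrier A" "y' \<in> carrier A"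
  shows "times A x y \<preceq> times A x' y'"
proof (rule leq_trans[of _ "times A x' y"])
  show "times A x y \<preceq> times A x' y"
    using assms times_join(2)[of x x' y] by (simp add: below_def)
  show "times A x' y \<preceq> times A x' y'"
    using assms times_join(1)[of x' y y'] by (simp add: below_def)
qed (use assms times_closed in auto)

lemma leq_one: "x \<in> carrier A \<Longrightarrow> x \<preceq> one_of A"
  using A wl unfolding M_sl_def by fastforce

lemma times_leq_left: "x \<in> carrier A \<Longrightarrow> y \<in> carrier A \<Longrightarrow> times A x y \<preceq> x"
  using times_mono[of x x y "one_of A"] by (simp add: leq_refl leq_one one_closed times_one)

lemma times_leq_right: "x \<in> carrier A \<Longrightarrow> y \<in> carrier A \<Longrightarrow> times A x y \<preceq> y"
  using times_mono[of x "one_of A" y y] by (simp add: leq_refl leq_one one_closed times_one)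

section \<open>Words and their values\<close>

definition ev :: "'a list \<Rightarrow> 'a" where
  "ev w = foldr (times A) w (one_of A)"

definition words :: "'a list set" where
  "words = lists S"

lemma words_simps [simp]:
  "[] \<in> words" "a # w \<in> words \<longleftrightarrow> a \<in> S \<and> w \<in> words" "v @ w \<in> words \<longleftrightarrow> v \<in> words \<and> w \<in> words"
  by (auto simp: words_def)

lemma ev_Nil [simp]: "ev [] = one_of A" and ev_Cons: "ev (a # w) = times A a (ev w)"
  by (simp_all add: ev_def)

lemma ev_closed [simp]: "w \<in> words \<Longrightarrow> ev w \<in> carrier A"
  using S_carrier by (induction w) (auto simp: ev_Cons one_closed times_closed)

lemma ev_append: "v \<in> words \<Longrightarrow> w \<in> words \<Longrightarrow> ev (v @ w) = times A (ev v) (ev w)"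
proof (induction v)
  case (Cons a v)
  then show ?case
    using S_carrier ev_closed by (auto simp: ev_Cons times_assoc subset_iff)
qed (use ev_closed in \<open>auto simp: times_one\<close>)

lemma ev_single: "a \<in> S \<Longrightarrow> ev [a] = a"
  using S_carrier by (auto simp: ev_Cons times_one)

lemma ev_antimono:
  assumes "subseq v w" "v \<in> words" "w \<in> words"
  shows "ev w \<preceq> ev v"
  using assms
proof (induction v w rule: list_emb.induct)
  case (list_emb_Nil w)
  then show ?case by (simp add: leq_one)
next
  case (list_emb_Cons v w a)
  then have "v \<in> words" "w \<in> words" "a \<in> carrier A" "ev w \<preceq> ev v"
    using S_carrier by auto
  then show ?case
    using leq_trans[OF times_leq_right, of a "ev w" "ev v"]
    by (simp add: ev_Cons times_closed)
next
  case (list_emb_Cons2 a b v w)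
  then have "v \<in> words" "w \<in> words" "b \<in> carrier A" "ev w \<preceq> ev v" "a = b"
    using S_carrier by auto
  then show ?case
    by (simp add: ev_Cons times_mono leq_refl)
qed

lemma ev_context_mono:
  assumes "ev v \<preceq> ev w" "p \<in> words" "v \<in> words" "w \<in> words" "q \<in> words"
  shows "ev (p @ v @ q) \<preceq> ev (p @ w @ q)"
  using assms by (simp add: ev_append times_mono times_closed leq_refl)

section \<open>Polars and their finiteness\<close>

text \<open>These are the basic closed sets of a residuated frame, with words on one side and
  contexts with a bound, \<open>(p, q, b)\<close>, on the other.\<close>

definition polar :: "'a list \<Rightarrow> 'a list \<Rightarrow> 'a \<Rightarrow> 'a list set" where
  "polar p q b = {w \<in> words. ev (p @ w @ q) \<preceq> b}"

lemma polar_upset: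
  assumes "v \<in> polar p q b" "ev w \<preceq> ev v" "p \<in> words" "q \<in> words" "b \<in> S" "w \<in> words"
  shows "w \<in> polar p q b"
  using assms leq_trans[OF ev_context_mono, of w v p q b] S_carrier
  by (auto simp: polar_def)

text \<open>For each of the finitely many \<open>b\<close>, both sides of the family are
  well-quasi-ordered: the words in a polar, and the contexts indexing it. Enlarging a context lowers
  all values and so enlarges the polar, as \<open>finite_upsets_wqo\<close> requires.\<close>

lemma finite_polars: "finite {polar p q b | p q b. p \<in> words \<and> q \<in> words \<and> b \<in> S}"
proof -
  have wqo: "wqo_on subseq words"
    unfolding words_def using finite_S by (rule higman_finite_alphabet)
  have "finite ((\<lambda>(p, q). polar p q b) ` (words \<times> words))" if b: "b \<in> S" for b
  proof (rule finite_upsets_wqo[OF wqo_on_Times[OF wqo wqo] wqo])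
    fix x y assume x: "x \<in> words \<times> words" and y: "y \<in> words \<times> words"
      and xy: "rel_prod subseq subseq x y"
    obtain p q p' q' where eq: "x = (p, q)" "y = (p', q')" by fastforce
    have "ev (p' @ w @ q') \<preceq> ev (p @ w @ q)" if "w \<in> words" for w
      using x y xy eq that by (intro ev_antimono list_emb_append_mono) auto
    then have "ev (p' @ w @ q') \<preceq> b" if "w \<in> words" "ev (p @ w @ q) \<preceq> b" for w
      by (rule leq_trans) (use that x y eq b S_carrier in auto)
    then show "(case x of (p, q) \<Rightarrow> polar p q b) \<subseteq> (case y of (p, q) \<Rightarrow> polar p q b)"
      by (auto simp: eq polar_def)
  next
    fix x v w assume "x \<in> words \<times> words" "v \<in> (case x of (p, q) \<Rightarrow> polar p q b)" "w \<in> words"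
      "subseq v w"
    then show "w \<in> (case x of (p, q) \<Rightarrow> polar p q b)"
      using polar_upset[OF _ ev_antimono, of v _ _ b w] b by (auto simp: polar_def)
  qed (auto simp: polar_def)
  then have "finite (\<Union>b\<in>S. (\<lambda>(p, q). polar p q b) ` (words \<times> words))"
    using finite_S by blast
  then show ?thesis
    by (rule rev_finite_subset) force
qed

section \<open>The closure operator\<close>

definition cl :: "'a list set \<Rightarrow> 'a list set" where
  "cl X = {w \<in> words. \<forall>p\<in>words. \<forall>q\<in>words. \<forall>b\<in>S. X \<subseteq> polar p q b \<longrightarrow> w \<in> polar p q b}"

lemma cl_words: "cl X \<subseteq> words"
  by (auto simp: cl_def)

lemma cl_extensive: "X \<subseteq> words \<Longrightarrow> X \<subseteq> cl X"
  by (auto simp: cl_def)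

lemma cl_mono: "X \<subseteq> Y \<Longrightarrow> cl X \<subseteq> cl Y"
  unfolding cl_def by blast

lemma cl_least:
  "p \<in> words \<Longrightarrow> q \<in> words \<Longrightarrow> b \<in> S \<Longrightarrow> X \<subseteq> polar p q b \<Longrightarrow> cl X \<subseteq> polar p q b"
  unfolding cl_def by blast

lemma cl_idem: "cl (cl X) = cl X"
proof
  show "cl (cl X) \<subseteq> cl X"
  proof
    fix w assume w: "w \<in> cl (cl X)"
    have "w \<in> polar p q b" if "p \<in> words" "q \<in> words" "b \<in> S" "X \<subseteq> polar p q b" for p q b
      using w that(1-3) cl_least[OF that] unfolding cl_def[of "cl X"] by blast
    moreover have "w \<in> words"
      using w cl_words by blast
    ultimately show "w \<in> cl X"
      unfolding cl_def by blast
  qed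
qed (intro cl_extensive cl_words)

definition closed :: "'a list set \<Rightarrow> bool" where
  "closed X \<longleftrightarrow> X \<subseteq> words \<and> cl X = X"

lemma closedI: "X \<subseteq> words \<Longrightarrow> cl X \<subseteq> X \<Longrightarrow> closed X"
  using cl_extensive by (auto simp: closed_def)

lemma closedD: "closed X \<Longrightarrow> X \<subseteq> words"
  by (simp add: closed_def)

lemma closed_cl: "closed (cl X)"
  by (simp add: closed_def cl_words cl_idem)

lemma cl_closed: "closed X \<Longrightarrow> cl X = X"
  by (simp add: closed_def)

lemma polar_words: "polar p q b \<subseteq> words"
  by (auto simp: polar_def)

lemma closed_polar: "p \<in> words \<Longrightarrow> q \<in> words \<Longrightarrow> b \<in> S \<Longrightarrow> closed (polar p q b)"
  by (intro closedI polar_words cl_least order_refl)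

lemma closed_words: "closed words"
  by (rule closedI[OF order_refl cl_words])

lemma cl_subset_iff: "X \<subseteq> words \<Longrightarrow> closed Y \<Longrightarrow> cl X \<subseteq> Y \<longleftrightarrow> X \<subseteq> Y"
  using cl_mono[of X Y] cl_extensive[of X] cl_closed[of Y] by blast

lemma closed_Int: "closed X \<Longrightarrow> closed Y \<Longrightarrow> closed (X \<inter> Y)"
  using cl_mono[of "X \<inter> Y" X] cl_mono[of "X \<inter> Y" Y] closedD[of X]
  by (intro closedI) (auto simp: cl_closed)

text \<open>Cutting down to \<open>words\<close> makes the empty intersection the top element, and
  gives the shape in which \<open>rneg\<close> and \<open>lneg\<close> are written.\<close>

lemma closed_Inter:
  assumes "\<And>i. i \<in> I \<Longrightarrow> closed (F i)"
  shows "closed {w \<in> words. \<forall>i\<in>I. w \<in> F i}"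
proof (rule closedI)
  have "cl {w \<in> words. \<forall>i\<in>I. w \<in> F i} \<subseteq> F i" if "i \<in> I" for i
    using cl_mono[of "{w \<in> words. \<forall>i\<in>I. w \<in> F i}" "F i"] cl_closed[OF assms[OF that]] that by auto
  then show "cl {w \<in> words. \<forall>i\<in>I. w \<in> F i} \<subseteq> {w \<in> words. \<forall>i\<in>I. w \<in> F i}"
    using cl_words by auto
qed auto

text \<open>Polars test a word only through the values of contexts filled with it, and these are
  monotone in the value of the word.\<close>

lemma closed_upset:
  assumes "closed X" "v \<in> X" "w \<in> words" "ev w \<preceq> ev v"
  shows "w \<in> X"
proof -
  have "w \<in> polar p q b" if "p \<in> words" "q \<in> words" "b \<in> S" "X \<subseteq> polar p q b" for p q b
    using assms that by (auto intro: polar_upset[of v _ _ _ w])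
  then have "w \<in> cl X"
    using assms(3) by (simp add: cl_def)
  then show ?thesis
    using cl_closed[OF assms(1)] by simp
qed

text \<open>A product lies below each factor because 1 is the top. Hence closed sets are two-sided
  ideals of the word monoid, which makes \<open>words\<close> the unit of their product.\<close>

lemma closed_append:
  assumes "closed X" "v \<in> words" "w \<in> words" and "v \<in> X \<or> w \<in> X"
  shows "v @ w \<in> X"
  using closed_upset[OF assms(1), of v "v @ w"] closed_upset[OF assms(1), of w "v @ w"] assms(2-4)
  by (auto simp: ev_append times_leq_left times_leq_right)

text \<open>A closed set is determined by the polars containing it.\<close>

lemma finite_closed: "finite {X. closed X}"
proof -
  let ?F = "{polar p q b | p q b. p \<in> words \<and> q \<in> words \<and> b \<in> S}"
  have "inj_on (\<lambda>X. {C \<in> ?F. X \<subseteq> C}) {X. closed X}"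
  proof (rule inj_onI)
    fix X Y assume XY: "X \<in> {X. closed X}" "Y \<in> {X. closed X}"
      "{C \<in> ?F. X \<subseteq> C} = {C \<in> ?F. Y \<subseteq> C}"
    have "X \<subseteq> polar p q b \<longleftrightarrow> Y \<subseteq> polar p q b" if "p \<in> words" "q \<in> words" "b \<in> S" for p q b
    proof -
      have "polar p q b \<in> ?F" using that by blast
      then show ?thesis using XY(3) by blast
    qed
    then have "cl X = cl Y"
      unfolding cl_def by (simp cong: ball_cong)
    then show "X = Y"
      using XY by (simp add: cl_closed)
  qed
  moreover have "finite ((\<lambda>X. {C \<in> ?F. X \<subseteq> C}) ` {X. closed X})"
    by (rule finite_subset[of _ "Pow ?F"]) (use finite_polars in auto)
  ultimately show ?thesis
    by (rule finite_imageD[rotated])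
qed

section \<open>Concatenation and the nucleus property\<close>

definition conc :: "'a list set \<Rightarrow> 'a list set \<Rightarrow> 'a list set" where
  "conc X Y = {x @ y | x y. x \<in> X \<and> y \<in> Y}"

lemma conc_subset_iff: "conc X Y \<subseteq> Z \<longleftrightarrow> (\<forall>x\<in>X. \<forall>y\<in>Y. x @ y \<in> Z)"
  unfolding conc_def by blast

lemma conc_words: "X \<subseteq> words \<Longrightarrow> Y \<subseteq> words \<Longrightarrow> conc X Y \<subseteq> words"
  by (auto simp: conc_subset_iff)

lemma conc_mono: "X \<subseteq> X' \<Longrightarrow> Y \<subseteq> Y' \<Longrightarrow> conc X Y \<subseteq> conc X' Y'"
  unfolding conc_def by blast

lemma conc_assoc: "conc (conc X Y) Z = conc X (conc Y Z)"
  by (auto simp: conc_def) (metis append.assoc)+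

lemma conc_Un: "conc X (Y \<union> Z) = conc X Y \<union> conc X Z" "conc (X \<union> Y) Z = conc X Z \<union> conc Y Z"
  by (auto simp: conc_def)

text \<open>Either factor can be absorbed into the context. Thus the residuals of a polar are again
  intersections of polars.\<close>

lemma conc_subset_polar:
  assumes "X \<subseteq> words" "Y \<subseteq> words"
  shows "conc X Y \<subseteq> polar p q b \<longleftrightarrow> (\<forall>y\<in>Y. X \<subseteq> polar p (y @ q) b)"
    and "conc X Y \<subseteq> polar p q b \<longleftrightarrow> (\<forall>x\<in>X. Y \<subseteq> polar (p @ x) q b)"
  using assms unfolding conc_subset_iff by (auto simp: polar_def subset_iff)

text \<open>The nucleus property. The factors are closed one at a time: with the other factor in the
  context, an inclusion in a polar passes to the closure by \<open>cl_least\<close>.\<close>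

lemma conc_cl_subset:
  assumes "X \<subseteq> words" "Y \<subseteq> words"
  shows "conc (cl X) (cl Y) \<subseteq> cl (conc X Y)"
proof -
  have "conc (cl X) (cl Y) \<subseteq> polar p q b"
    if pqb: "p \<in> words" "q \<in> words" "b \<in> S" and *: "conc X Y \<subseteq> polar p q b" for p q b
  proof -
    have "cl X \<subseteq> polar p (y @ q) b" if "y \<in> Y" for y
      using * conc_subset_polar(1)[OF assms] that pqb assms
      by (intro cl_least) auto
    then have "conc (cl X) Y \<subseteq> polar p q b"
      using conc_subset_polar(1)[OF cl_words assms(2)] by blast
    then have "cl Y \<subseteq> polar (p @ x) q b" if "x \<in> cl X" for x
      using conc_subset_polar(2)[OF cl_words assms(2)] that pqb cl_words[of X]
      by (intro cl_least) auto
    then show ?thesis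
      using conc_subset_polar(2)[OF cl_words cl_words] by blast
  qed
  then show ?thesis
    using conc_words[OF cl_words cl_words, of X Y] unfolding cl_def[of "conc X Y"] by blast
qed

lemma cl_conc_cl:
  assumes "X \<subseteq> words" "Y \<subseteq> words"
  shows "cl (conc (cl X) Y) = cl (conc X Y)" "cl (conc X (cl Y)) = cl (conc X Y)"
proof -
  \<comment> \<open>Sandwiching arbitrary \<open>X'\<close> and \<open>Y'\<close> between the sets
    and their closures covers both equations at once.\<close>
  have eq: "cl (conc X' Y') = cl (conc X Y)"
    if "X \<subseteq> X'" "Y \<subseteq> Y'" "X' \<subseteq> cl X" "Y' \<subseteq> cl Y" for X' Y'
  proof
    show "cl (conc X Y) \<subseteq> cl (conc X' Y')"
      using that by (intro cl_mono conc_mono)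
    have "conc X' Y' \<subseteq> cl (conc X Y)"
      using conc_mono[OF that(3,4)] conc_cl_subset[OF assms] by blast
    then show "cl (conc X' Y') \<subseteq> cl (conc X Y)"
      using cl_mono[of "conc X' Y'" "cl (conc X Y)"] by (simp add: cl_idem)
  qed
  show "cl (conc (cl X) Y) = cl (conc X Y)" "cl (conc X (cl Y)) = cl (conc X Y)"
    using eq[of "cl X" Y] eq[of X "cl Y"] assms by (simp_all add: cl_extensive)
qed

lemma cl_Un_cl:
  assumes "X \<subseteq> words" "Y \<subseteq> words"
  shows "cl (cl X \<union> Y) = cl (X \<union> Y)" "cl (X \<union> cl Y) = cl (X \<union> Y)"
proof -
  have eq: "cl (X' \<union> Y') = cl (X \<union> Y)" if "X \<subseteq> X'" "Y \<subseteq> Y'" "X' \<subseteq> cl X" "Y' \<subseteq> cl Y" for X' Y'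
  proof
    show "cl (X \<union> Y) \<subseteq> cl (X' \<union> Y')"
      using that by (intro cl_mono) blast
    have "X' \<union> Y' \<subseteq> cl (X \<union> Y)"
      using that cl_mono[of X "X \<union> Y"] cl_mono[of Y "X \<union> Y"] by blast
    then show "cl (X' \<union> Y') \<subseteq> cl (X \<union> Y)"
      using cl_mono[of "X' \<union> Y'" "cl (X \<union> Y)"] by (simp add: cl_idem)
  qed
  show "cl (cl X \<union> Y) = cl (X \<union> Y)" "cl (X \<union> cl Y) = cl (X \<union> Y)"
    using eq[of "cl X" Y] eq[of X "cl Y"] assms by (simp_all add: cl_extensive)
qed

section \<open>Principal closed sets and residuals of 0\<close>

definition down :: "'a \<Rightarrow> 'a list set" where
  "down b = {w \<in> words. ev w \<preceq> b}"

lemma down_eq_polar: "down b = polar [] [] b"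
  by (simp add: down_def polar_def)

lemma closed_down: "b \<in> S \<Longrightarrow> closed (down b)"
  by (simp add: down_eq_polar closed_polar)

text \<open>\<open>rneg\<close> and \<open>lneg\<close> are the two residuals of
  \<open>down (zero_of A)\<close> in the word monoid. They make sense even if \<open>A\<close> has
  no pseudocomplements.\<close>

definition rneg :: "'a list set \<Rightarrow> 'a list set" where
  "rneg X = {y \<in> words. \<forall>x\<in>X. ev (x @ y) \<preceq> zero_of A}"

definition lneg :: "'a list set \<Rightarrow> 'a list set" where
  "lneg Y = {x \<in> words. \<forall>y\<in>Y. ev (x @ y) \<preceq> zero_of A}"

lemma closed_rneg: "X \<subseteq> words \<Longrightarrow> closed (rneg X)"
proof -
  assume "X \<subseteq> words"
  then have "closed {y \<in> words. \<forall>x\<in>X. y \<in> polar x [] (zero_of A)}"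
    using zero_S by (intro closed_Inter closed_polar) auto
  moreover have "{y \<in> words. \<forall>x\<in>X. y \<in> polar x [] (zero_of A)} = rneg X"
    by (auto simp: rneg_def polar_def)
  ultimately show ?thesis by simp
qed

lemma closed_lneg: "Y \<subseteq> words \<Longrightarrow> closed (lneg Y)"
proof -
  assume "Y \<subseteq> words"
  then have "closed {x \<in> words. \<forall>y\<in>Y. x \<in> polar [] y (zero_of A)}"
    using zero_S by (intro closed_Inter closed_polar) auto
  moreover have "{x \<in> words. \<forall>y\<in>Y. x \<in> polar [] y (zero_of A)} = lneg Y"
    by (auto simp: lneg_def polar_def)
  ultimately show ?thesis by simp
qed

section \<open>The residuated lattice of closed sets\<close>

definition closure_algebra :: "('a list set, opsym) algebra" where
  "closure_algebra = \<lparr>carrier = {X. closed X}, interp = (\<lambda>f xs. case f of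
     Join \<Rightarrow> cl (xs ! 0 \<union> xs ! 1)
   | Meet \<Rightarrow> xs ! 0 \<inter> xs ! 1
   | Times \<Rightarrow> cl (conc (xs ! 0) (xs ! 1))
   | NegR \<Rightarrow> rneg (xs ! 0)
   | NegL \<Rightarrow> lneg (xs ! 0)
   | Zero \<Rightarrow> down (zero_of A)
   | One \<Rightarrow> words)\<rparr>"

lemma carrier_closure_algebra [simp]: "carrier closure_algebra = {X. closed X}"
  by (simp add: closure_algebra_def)

lemma closure_algebra_simps [simp]:
  "join closure_algebra X Y = cl (X \<union> Y)"
  "meet closure_algebra X Y = X \<inter> Y"
  "times closure_algebra X Y = cl (conc X Y)"
  "negr closure_algebra X = rneg X"
  "negl closure_algebra X = lneg X"
  "zero_of closure_algebra = down (zero_of A)"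
  "one_of closure_algebra = words"
  by (simp_all add: closure_algebra_def)

lemma below_closure_algebra:
  assumes "closed X" "closed Y"
  shows "below closure_algebra X Y \<longleftrightarrow> X \<subseteq> Y"
proof -
  have "X \<union> Y \<subseteq> words"
    using assms by (auto simp: closed_def)
  then have "cl (X \<union> Y) = Y \<longleftrightarrow> X \<union> Y \<subseteq> Y"
    using cl_extensive[of "X \<union> Y"] cl_closed[OF assms(2)] by (auto simp: Un_absorb1)
  then show ?thesis
    by (simp add: below_def)
qed

lemma is_algebra_closure_algebra: "is_algebra p_lat_sig closure_algebra"
  using zero_S by (simp add: is_algebra_p_lat_iff closed_cl closed_Int closed_rneg closed_lneg
      closed_down closed_words closedD)

lemma times_one_closure_algebra:
  assumes X: "closed X"
  shows "cl (conc words X) = X" "cl (conc X words) = X"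
proof -
  have "conc words X \<subseteq> X" "conc X words \<subseteq> X"
    unfolding conc_subset_iff using closed_append[OF X] closedD[OF X] by blast+
  moreover have "X \<subseteq> conc words X" "X \<subseteq> conc X words"
    unfolding conc_def using append_Nil append_Nil2 by (blast intro: words_simps(1))+
  ultimately show "cl (conc words X) = X" "cl (conc X words) = X"
    using cl_closed[OF X] by auto
qed

text \<open>Words do not commute, but their values do, so no polar separates \<open>v @ w\<close>
  from \<open>w @ v\<close>.\<close>

lemma conc_commute:
  assumes "L_e \<in> set \<sigma>" "X \<subseteq> words" "Y \<subseteq> words"
  shows "cl (conc X Y) = cl (conc Y X)"
proof -
  have comm: "times A x y = times A y x" if "x \<in> carrier A" "y \<in> carrier A" for x y
    using A assms(1) that unfolding M_sl_def by fastforce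
  have "ev (p @ (v @ w) @ q) = ev (p @ (w @ v) @ q)"
    if "p \<in> words" "v \<in> words" "w \<in> words" "q \<in> words" for p q v w
    using that comm[of "ev v" "ev w"] ev_append[of "v @ w" q] ev_append[of "w @ v" q]
    by (simp add: ev_append[of p] ev_append[of v w] ev_append[of w v] del: append_assoc)
  then have "conc X Y \<subseteq> polar p q b \<longleftrightarrow> conc Y X \<subseteq> polar p q b"
    if "p \<in> words" "q \<in> words" for p q b
    using that assms(2,3) by (fastforce simp: conc_def polar_def subset_iff simp del: append_assoc)
  then show ?thesis
    unfolding cl_def by blast
qed

lemma satisfies_closure_algebra:
  assumes "l \<in> set \<sigma>"
  shows "satisfies closure_algebra l"
proof (cases l)
  case L_e
  then show ?thesis
    using assms by (simp add: conc_commute closedD)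
next
  case L_wl
  then show ?thesis
    by (simp add: below_closure_algebra closed_words closedD)
next
  case L_wr
  have zero_least: "zero_of A \<preceq> x" if "x \<in> carrier A" for x
    using A assms L_wr that unfolding M_sl_def by fastforce
  \<comment> \<open>A context can only lower a value, so a word below 0 stays below 0 in every
    context, and 0 is below every bound.\<close>
  have "down (zero_of A) \<subseteq> polar p q b" if "p \<in> words" "q \<in> words" "b \<in> S" for p q b
  proof
    fix w assume w: "w \<in> down (zero_of A)"
    have "ev (p @ w @ q) \<preceq> ev w"
      using w that by (intro ev_antimono) (auto simp: down_def)
    then have "ev (p @ w @ q) \<preceq> zero_of A"
      by (rule leq_trans) (use w that in \<open>auto simp: down_def zero_closed\<close>)
    then have "ev (p @ w @ q) \<preceq> b"
      by (rule leq_trans) (use w that S_carrier in \<open>auto simp: down_def zero_closed intro: zero_least\<close>)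
    then show "w \<in> polar p q b"
      using w by (simp add: polar_def down_def)
  qed
  then have "down (zero_of A) \<subseteq> cl X" for X
    unfolding cl_def down_def by blast
  then have "down (zero_of A) \<subseteq> X" if "closed X" for X
    using cl_closed[OF that] by metis
  then show ?thesis
    using L_wr by (simp add: below_closure_algebra closed_down zero_S)
next
  case L_c
  have "x \<preceq> times A x x" if "x \<in> carrier A" for x
    using A assms L_c that unfolding M_sl_def by fastforce
  then have "ev w \<preceq> ev (w @ w)" if "w \<in> words" for w
    using that by (simp add: ev_append)
  \<comment> \<open>For \<open>w\<close> in \<open>X\<close> the word \<open>w @ w\<close> is in the
    product; \<open>w\<close> has a smaller or equal value, so it follows by
    \<open>closed_upset\<close>.\<close>
  then have "X \<subseteq> cl (conc X X)" if "closed X" for X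
  proof -
    have "w \<in> cl (conc X X)" if "w \<in> X" for w
    proof (rule closed_upset[OF closed_cl])
      show "w @ w \<in> cl (conc X X)"
        using that cl_extensive[OF conc_words[of X X]] closedD[OF \<open>closed X\<close>]
        by (auto simp: conc_def)
      show "w \<in> words" "ev w \<preceq> ev (w @ w)"
        using that closedD[OF \<open>closed X\<close>] \<open>\<And>w. w \<in> words \<Longrightarrow> ev w \<preceq> ev (w @ w)\<close> by auto
    qed
    then show ?thesis by blast
  qed
  then show ?thesis
    using L_c by (simp add: below_closure_algebra closed_cl)
qed

lemma closure_algebra_M_lat: "closure_algebra \<in> M_lat \<sigma>"
proof -
  have alg: "is_algebra lat_sig closure_algebra" "is_algebra sl_sig closure_algebra"
    using is_algebra_closure_algebra sig_le by (blast intro: is_algebra_mono)+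
  have join: "semilattice_on {X. closed X} (\<lambda>X Y. cl (X \<union> Y))"
    unfolding semilattice_on_def
    by (auto simp: closedD closed_cl cl_Un_cl cl_closed Un_ac)
  have meet: "semilattice_on {X. closed X} (\<inter>)"
    unfolding semilattice_on_def by (auto simp: closed_Int)
  have absorb: "cl (X \<union> X \<inter> Y) = X" "X \<inter> cl (X \<union> Y) = X" if "closed X" "closed Y" for X Y
    using that cl_extensive[of "X \<union> Y"] by (auto simp: closedD cl_closed Un_absorb2)
  have monoid: "monoid \<lparr>carrier = {X. closed X}, mult = (\<lambda>X Y. cl (conc X Y)), one = words\<rparr>"
    by (rule monoidI)
      (auto simp: closed_cl closed_words times_one_closure_algebra cl_conc_cl conc_words closedD
        conc_assoc)
  have distrib: "cl (conc X (cl (Y \<union> Z))) = cl (cl (conc X Y) \<union> cl (conc X Z))"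
    "cl (conc (cl (X \<union> Y)) Z) = cl (cl (conc X Z) \<union> cl (conc Y Z))"
    if "closed X" "closed Y" "closed Z" for X Y Z
    using that by (simp_all add: closedD cl_words cl_conc_cl cl_Un_cl conc_words conc_Un)
  show ?thesis
    unfolding M_lat_def M_sl_def lattice_on_def
    using alg join meet absorb monoid distrib satisfies_closure_algebra by simp
qed

text \<open>All three conditions say that \<open>ev (x @ y)\<close> is below 0 for all
  \<open>x\<close> in \<open>X\<close> and \<open>y\<close> in \<open>Y\<close>.\<close>

lemma pseudocomplements_closure_algebra: "pseudocomplements closure_algebra"
proof -
  have "cl (conc X Y) \<subseteq> down (zero_of A) \<longleftrightarrow> Y \<subseteq> rneg X" "Y \<subseteq> rneg X \<longleftrightarrow> X \<subseteq> lneg Y"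
    if "closed X" "closed Y" for X Y
  proof -
    note XY = closedD[OF that(1)] closedD[OF that(2)]
    have "cl (conc X Y) \<subseteq> down (zero_of A) \<longleftrightarrow> conc X Y \<subseteq> down (zero_of A)"
      using XY by (intro cl_subset_iff conc_words closed_down zero_S)
    also have "\<dots> \<longleftrightarrow> Y \<subseteq> rneg X"
      using XY unfolding conc_subset_iff by (auto simp: down_def rneg_def subset_iff)
    finally show "cl (conc X Y) \<subseteq> down (zero_of A) \<longleftrightarrow> Y \<subseteq> rneg X" .
    show "Y \<subseteq> rneg X \<longleftrightarrow> X \<subseteq> lneg Y"
      using XY by (auto simp: lneg_def rneg_def subset_iff)
  qed
  then show ?thesis
    unfolding pseudocomplements_def
    by (simp add: below_closure_algebra closed_cl closed_down zero_S closed_rneg closed_lneg closedD)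
qed

section \<open>Preservation of the defined operations\<close>

lemma single_in_down: "a \<in> S \<Longrightarrow> [a] \<in> down b \<longleftrightarrow> a \<preceq> b"
  by (simp add: down_def ev_single)

text \<open>\<open>down a\<close> is the closed set generated by the one-letter word
  \<open>[a]\<close>, so inclusions between closed sets reduce to membership of a single
  word.\<close>

lemma down_subset_iff:
  assumes "a \<in> S" "closed X"
  shows "down a \<subseteq> X \<longleftrightarrow> [a] \<in> X"
proof
  have "[a] \<in> down a"
    using assms(1) S_carrier by (auto simp: single_in_down leq_refl)
  then show "down a \<subseteq> X \<Longrightarrow> [a] \<in> X" by blast
  assume "[a] \<in> X"
  then show "down a \<subseteq> X"
    using closed_upset[OF assms(2)] assms(1) by (auto simp: down_def ev_single)
qed

lemma inj_down: "inj_on down S"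
proof (rule inj_onI)
  fix a b assume ab: "a \<in> S" "b \<in> S" "down a = down b"
  have "[a] \<in> down a" "[b] \<in> down b"
    using ab(1,2) leq_refl S_carrier by (auto simp: single_in_down)
  then have "a \<preceq> b" "b \<preceq> a"
    using ab by (metis single_in_down)+
  then show "a = b"
    using ab S_carrier leq_antisym by blast
qed

lemma down_join:
  assumes "a \<in> S" "b \<in> S" "join A a b \<in> S"
  shows "down (join A a b) = cl (down a \<union> down b)"
proof
  note c = assms[THEN subsetD[OF S_carrier]]
  have "a \<preceq> join A a b" "b \<preceq> join A a b"
    using join_leq_iff[of a b "join A a b"] leq_refl c by auto
  then have "[a] \<in> down (join A a b)" "[b] \<in> down (join A a b)"
    using assms by (auto simp: single_in_down)
  then show "cl (down a \<union> down b) \<subseteq> down (join A a b)"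
    using assms by (intro cl_subset_iff[THEN iffD2]) (auto simp: closed_down down_subset_iff closedD)
  have "[join A a b] \<in> polar p q d"
    if pqd: "p \<in> words" "q \<in> words" "d \<in> S" and sub: "down a \<union> down b \<subseteq> polar p q d" for p q d
  proof -
    have "[a] \<in> polar p q d" "[b] \<in> polar p q d"
      using sub pqd assms by (simp_all add: down_subset_iff closed_polar)
    \<comment> \<open>Distributivity on both sides carries the join out of the context; a bound for
      both parts then bounds their join.\<close>
    moreover have "ev (p @ [join A a b] @ q) = join A (ev (p @ [a] @ q)) (ev (p @ [b] @ q))"
      using pqd assms c
      by (simp add: ev_append ev_Cons times_join times_closed)
    ultimately show ?thesis
      using pqd assms(3) S_carrier c assms by (auto simp: polar_def join_leq_iff)
  qed
  then have "[join A a b] \<in> cl (down a \<union> down b)"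
    using assms by (auto simp: cl_def)
  then show "down (join A a b) \<subseteq> cl (down a \<union> down b)"
    using assms by (simp add: down_subset_iff closed_cl)
qed

lemma down_meet:
  assumes "lattice_on (carrier A) (join A) (meet A)" "a \<in> S" "b \<in> S" "meet A a b \<in> S"
  shows "down (meet A a b) = down a \<inter> down b"
proof -
  have sm: "semilattice_on (carrier A) (meet A)"
    using assms(1) by (simp add: lattice_on_def)
  have meet_iff: "x \<preceq> y \<longleftrightarrow> meet A y x = x" if "x \<in> carrier A" "y \<in> carrier A" for x y
    using assms(1) that unfolding lattice_on_def semilattice_on_def below_def by metis
  have "x \<preceq> meet A a b \<longleftrightarrow> x \<preceq> a \<and> x \<preceq> b" if "x \<in> carrier A" for x
    using semilattice_on_absorb_iff[OF sm, of a b x] assms(2-4) S_carrier that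
    by (auto simp: meet_iff subset_iff)
  then show ?thesis
    by (auto simp: down_def)
qed

lemma down_times:
  assumes "a \<in> S" "b \<in> S" "times A a b \<in> S"
  shows "down (times A a b) = cl (conc (down a) (down b))"
proof
  note c = assms[THEN subsetD[OF S_carrier]]
  have ev_ab: "ev [a, b] = times A a b"
    using c by (simp add: ev_Cons times_one)
  have "times A (ev v) (ev w) \<preceq> times A a b" if "v \<in> down a" "w \<in> down b" for v w
    using that c by (intro times_mono) (auto simp: down_def)
  then have "conc (down a) (down b) \<subseteq> down (times A a b)"
    unfolding conc_subset_iff by (auto simp: down_def ev_append)
  then show "cl (conc (down a) (down b)) \<subseteq> down (times A a b)"
    using assms by (intro cl_subset_iff[THEN iffD2] conc_words) (auto simp: closed_down closedD)
  have "[a] \<in> down a" "[b] \<in> down b"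
    using assms down_subset_iff[of a "down a"] down_subset_iff[of b "down b"]
    by (simp_all add: closed_down)
  then have "[a] @ [b] \<in> conc (down a) (down b)"
    unfolding conc_def by blast
  \<comment> \<open>The words \<open>[a, b]\<close> and \<open>[times A a b]\<close> have the same
    value, and closed sets see only values.\<close>
  then have "[a, b] \<in> cl (conc (down a) (down b))"
    using cl_extensive[OF conc_words[of "down a" "down b"]] assms by (auto simp: closed_down closedD)
  then have "[times A a b] \<in> cl (conc (down a) (down b))"
    by (rule closed_upset[OF closed_cl]) (use assms c ev_ab in \<open>simp_all add: ev_single leq_refl\<close>)
  then show "down (times A a b) \<subseteq> cl (conc (down a) (down b))"
    using assms by (simp add: down_subset_iff closed_cl)
qed

text \<open>With \<open>y\<close> taken as right context, membership in \<open>rneg (down a)\<close>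
  becomes an inclusion of \<open>down a\<close> in a polar, which is tested on \<open>[a]\<close>
  alone. For \<open>negl\<close> the word becomes a left context.\<close>

lemma down_negr:
  assumes "pseudocomplements A" "a \<in> S" "negr A a \<in> S"
  shows "down (negr A a) = rneg (down a)"
proof -
  have "y \<in> down (negr A a) \<longleftrightarrow> y \<in> rneg (down a)" if y: "y \<in> words" for y
  proof -
    have "y \<in> down (negr A a) \<longleftrightarrow> times A a (ev y) \<preceq> zero_of A"
      using assms S_carrier y by (auto simp: down_def pseudocomplements_def)
    also have "\<dots> \<longleftrightarrow> [a] \<in> polar [] y (zero_of A)"
      using assms(2) y by (simp add: polar_def ev_Cons)
    also have "\<dots> \<longleftrightarrow> down a \<subseteq> polar [] y (zero_of A)"
      using assms(2) y zero_S by (simp add: down_subset_iff closed_polar)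
    also have "\<dots> \<longleftrightarrow> y \<in> rneg (down a)"
      using y by (auto simp: rneg_def polar_def down_def)
    finally show ?thesis .
  qed
  then show ?thesis
    by (auto simp: down_def rneg_def)
qed

lemma down_negl:
  assumes "pseudocomplements A" "a \<in> S" "negl A a \<in> S"
  shows "down (negl A a) = lneg (down a)"
proof -
  have "x \<in> down (negl A a) \<longleftrightarrow> x \<in> lneg (down a)" if x: "x \<in> words" for x
  proof -
    have "x \<in> down (negl A a) \<longleftrightarrow> times A (ev x) a \<preceq> zero_of A"
      using assms S_carrier x by (auto simp: down_def pseudocomplements_def)
    also have "\<dots> \<longleftrightarrow> [a] \<in> polar x [] (zero_of A)"
      using assms(2) x by (simp add: polar_def ev_append ev_single)
    also have "\<dots> \<longleftrightarrow> down a \<subseteq> polar x [] (zero_of A)"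
      using assms(2) x zero_S by (simp add: down_subset_iff closed_polar)
    also have "\<dots> \<longleftrightarrow> x \<in> lneg (down a)"
      using x by (auto simp: lneg_def polar_def down_def)
    finally show ?thesis .
  qed
  then show ?thesis
    by (auto simp: down_def lneg_def)
qed

lemma down_one: "down (one_of A) = words"
  by (auto simp: down_def leq_one)

text \<open>Uniform in the signature: further structure on \<open>A\<close> is demanded only when
  \<open>sg\<close> contains the operation it serves.\<close>

lemma partial_embedding_down:
  assumes sg: "sg \<subseteq>\<^sub>m p_lat_sig"
    and lat: "Meet \<in> dom sg \<Longrightarrow> lattice_on (carrier A) (join A) (meet A)"
    and pc: "NegR \<in> dom sg \<or> NegL \<in> dom sg \<Longrightarrow> pseudocomplements A"
    and B: "B \<subseteq> S"
  shows "partial_embedding sg A B closure_algebra down"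
  unfolding partial_embedding_def
proof (intro conjI allI impI)
  show "down ` B \<subseteq> carrier closure_algebra"
    using B closed_down by auto
  show "inj_on down B"
    using inj_on_subset[OF inj_down B] .
  fix f n xs
  assume *: "sg f = Some n \<and> length xs = n \<and> set xs \<subseteq> B \<and> interp A f xs \<in> B"
  then have f: "f \<in> dom sg" and sig: "p_lat_sig f = Some n" "length xs = n"
    using sg by (auto simp: map_le_def domIff dest!: bspec)
  have xs: "set xs \<subseteq> S" "interp A f xs \<in> S"
    using * B by auto
  from sig show "down (interp A f xs) = interp closure_algebra f (map down xs)"
    by (cases rule: p_lat_sig_cases)
      (use xs f lat pc in
        \<open>auto simp: down_join down_meet down_times down_negr down_negl down_one\<close>)
qed

end

subsection \<open>Transport along an injection\<close>

definition transport :: "('b \<Rightarrow> 'a) \<Rightarrow> ('b, 'f) algebra \<Rightarrow> ('a, 'f) algebra" where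
  "transport g D = \<lparr>carrier = g ` carrier D,
     interp = (\<lambda>f xs. g (interp D f (map (inv_into (carrier D) g) xs)))\<rparr>"

lemma carrier_transport [simp]: "carrier (transport g D) = g ` carrier D"
  by (simp add: transport_def)

lemma interp_transport:
  assumes "inj_on g (carrier D)" "set xs \<subseteq> carrier D"
  shows "interp (transport g D) f (map g xs) = g (interp D f xs)"
proof -
  have "map (inv_into (carrier D) g) (map g xs) = xs"
    using assms by (auto intro!: map_idI simp: subset_iff)
  then show ?thesis
    by (simp add: transport_def del: map_map)
qed

lemma is_algebra_transport:
  assumes "inj_on g (carrier D)" "is_algebra sg D"
  shows "is_algebra sg (transport g D)"
  unfolding is_algebra_def
proof (intro allI impI)
  fix f n xs
  assume *: "sg f = Some n \<and> length xs = n \<and> set xs \<subseteq> carrier (transport g D)"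
  then have "set (map (inv_into (carrier D) g) xs) \<subseteq> carrier D"
    by (auto simp: subset_iff intro: inv_into_into)
  then have "interp D f (map (inv_into (carrier D) g) xs) \<in> carrier D"
    using * assms(2) by (simp add: is_algebra_def)
  then show "interp (transport g D) f xs \<in> carrier (transport g D)"
    by (simp add: transport_def)
qed

lemma partial_embedding_transport:
  assumes g: "inj_on g (carrier D)" and h: "partial_embedding sg A B D h"
  shows "partial_embedding sg A B (transport g D) (g \<circ> h)"
  unfolding partial_embedding_def
proof (intro conjI allI impI)
  show "(g \<circ> h) ` B \<subseteq> carrier (transport g D)" "inj_on (g \<circ> h) B"
    using h g by (auto simp: partial_embedding_def intro: comp_inj_on inj_on_subset)
  fix f n xs
  assume *: "sg f = Some n \<and> length xs = n \<and> set xs \<subseteq> B \<and> interp A f xs \<in> B"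
  then have "h (interp A f xs) = interp D f (map h xs)" "set (map h xs) \<subseteq> carrier D"
    using h by (auto simp: partial_embedding_def image_subset_iff subset_iff)
  then show "(g \<circ> h) (interp A f xs) = interp (transport g D) f (map (g \<circ> h) xs)"
    using interp_transport[OF g, of "map h xs" f] by simp
qed

context
  fixes g :: "'b \<Rightarrow> 'a" and D :: "('b, opsym) algebra" and \<sigma> :: "letter list"
  assumes g: "inj_on g (carrier D)"
begin

lemma transport_simps:
  "x \<in> carrier D \<Longrightarrow> y \<in> carrier D \<Longrightarrow> join (transport g D) (g x) (g y) = g (join D x y)"
  "x \<in> carrier D \<Longrightarrow> y \<in> carrier D \<Longrightarrow> meet (transport g D) (g x) (g y) = g (meet D x y)"
  "x \<in> carrier D \<Longrightarrow> y \<in> carrier D \<Longrightarrow> times (transport g D) (g x) (g y) = g (times D x y)"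
  "x \<in> carrier D \<Longrightarrow> negr (transport g D) (g x) = g (negr D x)"
  "x \<in> carrier D \<Longrightarrow> negl (transport g D) (g x) = g (negl D x)"
  "zero_of (transport g D) = g (zero_of D)"
  "one_of (transport g D) = g (one_of D)"
  using interp_transport[OF g, of "[x, y]"] interp_transport[OF g, of "[x]"]
    interp_transport[OF g, of "[]"] by simp_all

lemma transport_semilattice_on:
  assumes "semilattice_on (carrier D) u"
    and v: "\<And>x y. x \<in> carrier D \<Longrightarrow> y \<in> carrier D \<Longrightarrow> v (g x) (g y) = g (u x y)"
  shows "semilattice_on (g ` carrier D) v"
proof -
  note u = assms(1)[unfolded semilattice_on_def]
  have "v (v (g x) (g y)) (g z) = v (g x) (v (g y) (g z))"
    if "x \<in> carrier D" "y \<in> carrier D" "z \<in> carrier D" for x y z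
  proof -
    have "u x y \<in> carrier D" "u y z \<in> carrier D" "u (u x y) z = u x (u y z)"
      using u that by blast+
    then show ?thesis
      using that by (simp add: v)
  qed
  then show ?thesis
    using u unfolding semilattice_on_def by (simp add: v)
qed

lemma below_transport:
  assumes "semilattice_on (carrier D) (join D)" "x \<in> carrier D" "y \<in> carrier D"
  shows "below (transport g D) (g x) (g y) \<longleftrightarrow> below D x y"
  using assms inj_on_eq_iff[OF g] by (simp add: below_def transport_simps semilattice_on_def)

lemma transport_M_lat:
  assumes D: "D \<in> M_lat \<sigma>"
  shows "transport g D \<in> M_lat \<sigma>"
proof -
  have lat: "lattice_on (carrier D) (join D) (meet D)" and alg: "is_algebra sl_sig D" "is_algebra lat_sig D"
    and mon: "monoid \<lparr>carrier = carrier D, mult = times D, one = one_of D\<rparr>"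
    and sat: "\<And>l. l \<in> set \<sigma> \<Longrightarrow> satisfies D l"
    and distrib: "\<And>x y z. x \<in> carrier D \<Longrightarrow> y \<in> carrier D \<Longrightarrow> z \<in> carrier D \<Longrightarrow>
        times D x (join D y z) = join D (times D x y) (times D x z) \<and>
        times D (join D x y) z = join D (times D x z) (times D y z)"
    using D by (auto simp: M_lat_def M_sl_def)
  have sl: "semilattice_on (carrier D) (join D)" "semilattice_on (carrier D) (meet D)"
    using lat by (auto simp: lattice_on_def)
  then have closed: "join D x y \<in> carrier D" "meet D x y \<in> carrier D" "times D x y \<in> carrier D"
    if "x \<in> carrier D" "y \<in> carrier D" for x y
    using that monoid.m_closed[OF mon, of x y] by (auto simp: semilattice_on_def)
  have one: "one_of D \<in> carrier D"
    using monoid.one_closed[OF mon] by simp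
  have zero: "zero_of D \<in> carrier D"
    using alg(1) by (simp add: is_algebra_def sl_sig_def)
  have "lattice_on (g ` carrier D) (join (transport g D)) (meet (transport g D))"
    using lat transport_semilattice_on[OF sl(1)] transport_semilattice_on[OF sl(2)] closed
    by (simp add: lattice_on_def transport_simps)
  moreover have "monoid \<lparr>carrier = g ` carrier D, mult = times (transport g D),
      one = one_of (transport g D)\<rparr>"
    using monoid.m_assoc[OF mon] monoid.l_one[OF mon] monoid.r_one[OF mon]
    by (intro monoidI) (auto simp: transport_simps closed one)
  moreover have "satisfies (transport g D) l" if "l \<in> set \<sigma>" for l
    using sat[OF that] one zero below_transport[OF sl(1)] closed
    by (cases l) (simp_all add: transport_simps)
  ultimately show ?thesis
    using is_algebra_transport[OF g] alg distrib
    by (simp add: M_lat_def M_sl_def lattice_on_def transport_simps closed)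
qed

lemma transport_pseudocomplements:
  assumes "is_algebra p_lat_sig D" "semilattice_on (carrier D) (join D)" "pseudocomplements D"
  shows "pseudocomplements (transport g D)"
proof -
  have *: "interp D f xs \<in> carrier D"
    if "p_lat_sig f = Some (length xs)" "set xs \<subseteq> carrier D" for f xs
    using that assms(1) by (simp add: is_algebra_def)
  have "times D x y \<in> carrier D" "negr D x \<in> carrier D" "negl D x \<in> carrier D" "zero_of D \<in> carrier D"
    if "x \<in> carrier D" "y \<in> carrier D" for x y
    using that by (auto intro!: * simp: p_lat_sig_def lat_sig_def sl_sig_def)
  then show ?thesis
    using assms(3) by (simp add: pseudocomplements_def transport_simps below_transport[OF assms(2)])
qed

end

subsection \<open>The finite embeddability property\<close>

lemma finite_model_of_integral:
  fixes A :: "('a, opsym) algebra"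
  assumes A: "A \<in> M_sl \<sigma>" and wl: "L_wl \<in> set \<sigma>"
    and B: "finite B" "B \<subseteq> carrier A" and inf: "infinite (carrier A)"
    and sg: "sg \<subseteq>\<^sub>m p_lat_sig"
    and lat: "Meet \<in> dom sg \<Longrightarrow> lattice_on (carrier A) (join A) (meet A)"
    and pc: "NegR \<in> dom sg \<or> NegL \<in> dom sg \<Longrightarrow> pseudocomplements A"
  obtains D :: "('a, opsym) algebra" and h
  where "D \<in> M_lat \<sigma>" "is_algebra p_lat_sig D" "pseudocomplements D" "finite (carrier D)"
    "partial_embedding sg A B D h"
proof -
  let ?S = "insert (zero_of A) (insert (one_of A) B)"
  have "zero_of A \<in> carrier A" "one_of A \<in> carrier A"
    using A by (auto simp: M_sl_def is_algebra_def sl_sig_def)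
  then interpret integral_sl_monoid A \<sigma> ?S
    using A wl B by unfold_locales auto
  let ?C = closure_algebra
  have fin: "finite (carrier ?C)"
    using finite_closed by simp
  \<comment> \<open>Only the size of \<open>Y\<close> matters: an infinite carrier has room for a
    copy of any finite algebra.\<close>
  obtain Y where Y: "finite Y" "card Y = card (carrier ?C)" "Y \<subseteq> carrier A"
    using infinite_arbitrarily_large[OF inf] by blast
  then obtain g where "bij_betw g (carrier ?C) Y"
    using finite_same_card_bij[OF fin] by metis
  then have g: "inj_on g (carrier ?C)"
    by (rule bij_betw_imp_inj_on)
  have sl: "semilattice_on (carrier ?C) (join ?C)"
    using closure_algebra_M_lat by (simp add: M_lat_def lattice_on_def)
  show thesis
  proof
    show "transport g ?C \<in> M_lat \<sigma>"
      using transport_M_lat[OF g closure_algebra_M_lat] .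
    show "is_algebra p_lat_sig (transport g ?C)"
      using is_algebra_transport[OF g is_algebra_closure_algebra] .
    show "pseudocomplements (transport g ?C)"
      using transport_pseudocomplements[OF g is_algebra_closure_algebra sl
          pseudocomplements_closure_algebra] .
    show "finite (carrier (transport g ?C))"
      using fin by simp
    show "partial_embedding sg A B (transport g ?C) (g \<circ> down)"
      using sg lat pc by (intro partial_embedding_transport[OF g] partial_embedding_down) auto
  qed
qed

text \<open>By hypothesis \<open>K\<close>, the class contains every algebra with the full
  structure. This fits each of the four classes, since operations outside a signature are
  ignored.\<close>

lemma finite_embeddability_property_of_integral:
  fixes K :: "('a, opsym) algebra set"
  assumes "K \<subseteq> M_sl \<sigma>" and "L_wl \<in> set \<sigma>" and "sg \<subseteq>\<^sub>m p_lat_sig"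
    and "\<And>A. A \<in> K \<Longrightarrow> Meet \<in> dom sg \<Longrightarrow> lattice_on (carrier A) (join A) (meet A)"
    and "\<And>A. A \<in> K \<Longrightarrow> NegR \<in> dom sg \<or> NegL \<in> dom sg \<Longrightarrow> pseudocomplements A"
    and K: "\<And>D. D \<in> M_lat \<sigma> \<Longrightarrow> is_algebra p_lat_sig D \<Longrightarrow> pseudocomplements D \<Longrightarrow> D \<in> K"
  shows "finite_embeddability_property sg K"
  unfolding finite_embeddability_property_def
proof (intro ballI allI impI)
  fix A B assume A: "A \<in> K" and B: "finite B \<and> B \<subseteq> carrier A"
  show "\<exists>D\<in>K. finite (carrier D) \<and> (\<exists>h. partial_embedding sg A B D h)"
  proof (cases "finite (carrier A)")
    case True
    \<comment> \<open>A finite \<open>A\<close> is its own finite extension of \<open>B\<close>; its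
      type may be too small for the closure algebra.\<close>
    have "partial_embedding sg A B A id"
      using B by (simp add: partial_embedding_def)
    with True A show ?thesis by blast
  next
    case False
    then obtain D :: "('a, opsym) algebra" and h
      where "D \<in> M_lat \<sigma>" "is_algebra p_lat_sig D" "pseudocomplements D" "finite (carrier D)"
        "partial_embedding sg A B D h"
      using finite_model_of_integral[of A \<sigma> B sg] assms A B by blast
    then show ?thesis
      using K by blast
  qed
qed

theorem theorem32:
  fixes \<sigma> :: "letter list"
  assumes "subseq \<sigma> [L_e, L_wl, L_wr, L_c]"
    and "L_wl \<in> set \<sigma>"
  shows "finite_embeddability_property sl_sig (M_sl \<sigma> :: ('a, opsym) algebra set)
    \<and> finite_embeddability_property lat_sig (M_lat \<sigma> :: ('a, opsym) algebra set)
    \<and> finite_embeddability_property p_sl_sig (PM_sl \<sigma> :: ('a, opsym) algebra set)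
    \<and> finite_embeddability_property p_lat_sig (PM_lat \<sigma> :: ('a, opsym) algebra set)"
proof (intro conjI; rule finite_embeddability_property_of_integral[where \<sigma> = \<sigma>])
qed (use assms(2) sig_le is_algebra_mono in
    \<open>auto simp: M_lat_def PM_sl_def PM_lat_def sl_sig_def lat_sig_def p_sl_sig_def\<close>)

end
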